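(* For all $x\in\mathbb C\setminus i(-\infty,0]$, $$e^{-x}\,\mathrm{Ei}^+(x)=-\Phi\left(-1,1,\tfrac{x}{i\pi}\right)+\sum_{k=1}^\infty\Phi\left(-e^{\pi i/2^k},1,2^k\tfrac{x}{i\pi}\right),$$ where the series converges.
   Context: $\mathrm{Ei}^+(x)=e^{x}\int_0^{\infty e^{i0-}}\frac{e^{-px}}{1-p}\,dp$ for $\arg x=0^+$, where the integral is along a ray $e^{i\phi}\mathbb R^+$ with $\phi<0$, $|\phi|$ small; $\mathrm{Ei}^+$ is then defined by analytic continuation, and on $\mathbb C\setminus i(-\infty,0]$ one takes the continuation with $\arg x\in(-\frac\pi2,\frac{3\pi}2)$. $\Phi(z,1,x)$ is the Lerch transcendent: $\Phi(z,1,x)=\int_0^\infty\frac{e^{-xp}}{1-ze^{-p}}\,dp$ for $\Re x>0$, $z\in\mathbb C\setminus[1,\infty)$, extended by analytic continuation in $x$ to $\mathbb C\setminus\{0,-1,-2,\dots\}$. *)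

theory Defs
  imports "HOL-Complex_Analysis.Complex_Analysis"
begin

text \<open>
  Both special functions below are analytic continuations, selected with \<open>SOME\<close>. Each defining
  condition fixes the function on a nonempty open subset of a connected open domain, so by the
  identity theorem all witnesses agree on that domain. Outside it the values are unspecified.
\<close>

definition slit_plane :: "complex set" where
  "slit_plane = - ((\<lambda>t::real. \<i> * of_real t) ` {..0})"

text \<open>
  The expression \<open>exp x\<close> times the integral of \<open>exp (- p * x) / (1 - p)\<close> over the ray
  \<open>p = r * cis \<phi>\<close>, \<open>r \<ge> 0\<close>; the leading \<open>cis \<phi>\<close> in the integrand comes from \<open>dp = cis \<phi> dr\<close>.
\<close>

definition Ei_ray :: "real \<Rightarrow> complex \<Rightarrow> complex" where
  "Ei_ray \<phi> x = exp x *
     (LBINT r:{0..}. cis \<phi> * (exp (- (of_real r * cis \<phi>) * x) / (1 - of_real r * cis \<phi>)))"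

text \<open>
  The conditions \<open>arg x = 0+\<close> and ``\<open>\<phi> < 0\<close>, \<open>\<bar>\<phi>\<bar>\<close> small'' are read as: for some \<open>\<epsilon> > 0\<close>, the
  function is given by the ray integral whenever \<open>0 < Arg x < \<epsilon>\<close> and \<open>- \<epsilon> < \<phi> < 0\<close>. Shrinking
  \<open>\<epsilon>\<close> weakens the condition, and for small \<open>\<epsilon>\<close> the integral does not depend on \<open>\<phi>\<close>.
\<close>

definition Ei_plus :: "complex \<Rightarrow> complex" where
  "Ei_plus = (SOME f. f holomorphic_on slit_plane \<and>
     (\<exists>\<epsilon>>0. \<forall>x \<phi>. 0 < Arg x \<and> Arg x < \<epsilon> \<and> - \<epsilon> < \<phi> \<and> \<phi> < 0 \<longrightarrow> f x = Ei_ray \<phi> x))"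

text \<open>\<open>lerch1 z x\<close> is \<open>\<Phi>(z, 1, x)\<close>; it is meaningful only for \<open>z\<close> outside \<open>[1, \<infinity>)\<close>.\<close>

definition lerch1 :: "complex \<Rightarrow> complex \<Rightarrow> complex" where
  "lerch1 z = (SOME f. f holomorphic_on (- \<int>\<^sub>\<le>\<^sub>0) \<and>
     (\<forall>x. 0 < Re x \<longrightarrow>
        f x = (LBINT p:{0..}. exp (- x * of_real p) / (1 - z * exp (- of_real p)))))"

end

theory Submission
  imports Defs
begin

text \<open>
  The identity is the Laplace transform of a dyadic expansion of the Cauchy kernel. Logarithmic
  differentiation of \<open>(1 - exp (- s)) / s = (\<Prod>k\<ge>1. (1 + exp (- s / 2 ^ k)) / 2)\<close> gives
  \<open>1 / s = 1 / (1 - exp (- s)) - (\<Sum>k\<ge>1. 2 ^ (- k) / (1 + exp (- s / 2 ^ k)))\<close>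
  (\<open>sums_dyadic_reciprocal\<close>). With \<open>s = i \<pi> (p - 1)\<close> the left-hand side is a multiple of the
  kernel \<open>1 / (1 - p)\<close> of \<open>Ei\<^sup>+\<close>, and each term on the right is, up to the scaling
  \<open>q = i \<pi> p / 2 ^ k\<close>, the kernel \<open>1 / (1 - z * exp (- q))\<close> of a Lerch transcendent.

  The rays \<open>p = r * cis \<phi>\<close> with \<open>\<phi> < 0\<close> turn into rays in the open right half-plane of \<open>q\<close>.
  There \<open>1 / (1 - z * exp (- q))\<close> has a geometric expansion, so the Laplace integral along
  \<^emph>\<open>any\<close> such ray is computed term by term and always gives the same series
  (\<open>lerch_ray_integral\<close>). This replaces rotation of contours. It remains to exchange the sum over
  \<open>k\<close> with the integral, which is dominated because the denominators of the kernels are bounded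
  below uniformly on the ray (\<open>norm_one_plus_exp_ge\<close>); this is \<open>Ei_ray_eq\<close>.

  The analytic continuations come from the same series. Summation by parts turns
  \<open>\<Sum>n. z ^ n / (n + w)\<close>, which for \<open>\<bar>z\<bar> = 1\<close> converges only conditionally, into an absolutely
  convergent series that is holomorphic off the nonpositive integers. It is \<open>O(1 / \<bar>w\<bar>)\<close> on every
  sector avoiding the negative axis, uniformly in the roots of unity that occur
  (\<open>norm_lerch_series_le\<close>). Hence the \<open>k\<close>-th term of the theorem is \<open>O(2 ^ (- k))\<close> locally
  uniformly on the slit plane, and the right-hand side is holomorphic there. So it exhibits the
  continuation of the ray integrals, and the identity theorem identifies it with the chosen one.
\<close>

section \<open>Laplace integrals of exponentials\<close>

lemma laplace_real:
  fixes a :: real assumes a: "a > 0"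
  shows "has_bochner_integral lborel (\<lambda>r. indicator {0..} r *\<^sub>R exp (- a * r)) (1 / a)"
proof -
  have lim: "((\<lambda>r. - exp (- a * r) / a) \<longlongrightarrow> 0) at_top" using a by real_asymp
  have "(\<integral>\<^sup>+r. ennreal (exp (- a * r)) * indicator {0..} r \<partial>lborel) = ennreal (0 - (- exp (- a * 0) / a))"
    by (rule nn_integral_FTC_atLeast[OF _ _ _ lim]) (use a in \<open>auto intro!: derivative_eq_intros simp: field_simps\<close>)
  also have "\<dots> = ennreal (1 / a)" by simp
  finally have "(\<integral>\<^sup>+r. ennreal (indicator {0..} r *\<^sub>R exp (- a * r)) \<partial>lborel) = ennreal (1 / a)"
    by (simp add: ennreal_mult' ennreal_indicator mult.commute)
  then show ?thesis
    by (intro has_bochner_integral_nn_integral) (use a in auto)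
qed

lemma laplace_real_id:
  fixes a :: real assumes a: "a > 0"
  shows "has_bochner_integral lborel (\<lambda>r. indicator {0..} r *\<^sub>R (r * exp (- a * r))) (1 / a\<^sup>2)"
proof -
  have lim: "((\<lambda>r. - (r / a + 1 / a\<^sup>2) * exp (- a * r)) \<longlongrightarrow> 0) at_top" using a by real_asymp
  have "(\<integral>\<^sup>+r. ennreal (indicator {0..} r *\<^sub>R (r * exp (- a * r))) \<partial>lborel)
      = (\<integral>\<^sup>+r. ennreal (r * exp (- a * r)) * indicator {0..} r \<partial>lborel)"
    by (intro nn_integral_cong) (auto simp: indicator_def)
  also have "\<dots> = ennreal (0 - (- (0 / a + 1 / a\<^sup>2) * exp (- a * 0)))"
    by (rule nn_integral_FTC_atLeast[OF _ _ _ lim]) (use a in \<open>auto intro!: derivative_eq_intros simp: field_simps power2_eq_square\<close>)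
  also have "\<dots> = ennreal (1 / a\<^sup>2)" by simp
  finally have "(\<integral>\<^sup>+r. ennreal (indicator {0..} r *\<^sub>R (r * exp (- a * r))) \<partial>lborel) = ennreal (1 / a\<^sup>2)" .
  then show ?thesis
    by (intro has_bochner_integral_nn_integral) (use a in \<open>auto simp: indicator_def\<close>)
qed

lemma laplace_complex:
  fixes c :: complex assumes c: "Re c > 0"
  shows "has_bochner_integral lborel (\<lambda>r. indicator {0..} r *\<^sub>R exp (- c * of_real r)) (1 / c)"
proof -
  let ?f = "\<lambda>r::real. exp (- c * of_real r)"
  have [simp]: "c \<noteq> 0" using c by auto
  have int: "integrable lborel (\<lambda>r. indicator {0..} r *\<^sub>R ?f r)"
    by (rule Bochner_Integration.integrable_bound[OF integrable.intros[OF laplace_real[OF c]]]) (auto simp: indicator_def)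
  have deriv: "((\<lambda>r. - exp (- c * of_real r) / c) has_vector_derivative ?f r) (at r within A)" for r A
    by (rule has_vector_derivative_real_field[where f = "\<lambda>s. - exp (- c * s) / c"])
       (auto intro!: derivative_eq_intros)
  have "((\<lambda>y. \<integral>r. indicator {..y} r *\<^sub>R (indicator {0..} r *\<^sub>R ?f r) \<partial>lborel)
      \<longlongrightarrow> (\<integral>r. indicator {0..} r *\<^sub>R ?f r \<partial>lborel)) at_top"
    by (rule tendsto_integral_at_top[OF _ int]) simp
  moreover have "\<forall>\<^sub>F y in at_top. (\<integral>r. indicator {..y} r *\<^sub>R (indicator {0..} r *\<^sub>R ?f r) \<partial>lborel)
      = (- exp (- c * of_real y) / c) - (- exp (- c * of_real 0) / c)"
    using eventually_ge_at_top[of "0::real"]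
  proof eventually_elim
    case (elim y)
    have "(\<integral>r. indicator {..y} r *\<^sub>R (indicator {0..} r *\<^sub>R ?f r) \<partial>lborel) = (\<integral>r. indicator {0..y} r *\<^sub>R ?f r \<partial>lborel)"
      by (intro Bochner_Integration.integral_cong) (auto simp: indicator_def)
    also have "\<dots> = (- exp (- c * of_real y) / c) - (- exp (- c * of_real 0) / c)"
      by (rule integral_FTC_atLeastAtMost[OF elim deriv]) (intro continuous_intros)
    finally show ?case .
  qed
  ultimately have "((\<lambda>y. (- exp (- c * of_real y) / c) - (- exp (- c * of_real 0) / c))
      \<longlongrightarrow> (\<integral>r. indicator {0..} r *\<^sub>R ?f r \<partial>lborel)) at_top"
    by (rule Lim_transform_eventually)
  moreover have "((\<lambda>y. (- exp (- c * of_real y) / c) - (- exp (- c * of_real 0) / c)) \<longlongrightarrow> 0 - (- exp (- c * of_real 0) / c)) at_top"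
  proof (rule tendsto_diff[OF _ tendsto_const])
    have "((\<lambda>y. exp (- Re c * y) / norm c) \<longlongrightarrow> 0) at_top" using c by real_asymp
    then have "((\<lambda>y. norm (- exp (- c * of_real y) / c)) \<longlongrightarrow> 0) at_top"
      by (simp add: norm_divide)
    then show "((\<lambda>y. - exp (- c * of_real y) / c) \<longlongrightarrow> 0) at_top"
      by (rule tendsto_norm_zero_cancel)
  qed
  ultimately have "(\<integral>r. indicator {0..} r *\<^sub>R ?f r \<partial>lborel) = 0 - (- exp (- c * of_real 0) / c)"
    by (rule tendsto_unique[OF trivial_limit_at_top_linorder])
  then show ?thesis using int by (simp add: has_bochner_integral_iff)
qed

section \<open>The Lerch transcendent as an absolutely convergent series\<close>

text \<open>
  The hypothesis says that \<open>w\<close> stays in a sector avoiding the negative axis: with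
  \<open>\<alpha> = Arg w\<close> it reads \<open>\<eta> \<le> (cos (\<alpha> / 2))\<^sup>2\<close>, and \<open>t + w\<close> has component
  \<open>(t + \<bar>w\<bar>) * cos (\<alpha> / 2)\<close> in the direction \<open>\<alpha> / 2\<close>.
\<close>

lemma norm_shift_ge:
  fixes w :: complex and t :: real
  assumes "w \<noteq> 0" "2 * \<eta> * norm w \<le> norm w + Re w"
  shows "\<eta> * (t + norm w)\<^sup>2 \<le> (norm (of_real t + w))\<^sup>2"
proof -
  define r where "r = norm w"
  have r: "r > 0" using assms(1) by (simp add: r_def)
  have rR: "(r - Re w) * (t - r)\<^sup>2 \<ge> 0" using complex_Re_le_cmod[of w] by (auto simp: r_def)
  have n: "(norm (of_real t + w))\<^sup>2 = t\<^sup>2 + 2 * t * Re w + r\<^sup>2"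
    unfolding r_def by (simp add: cmod_power2 power2_sum)
  have "2 * r * (\<eta> * (t + r)\<^sup>2) = (2 * \<eta> * r) * (t + r)\<^sup>2" by simp
  also have "\<dots> \<le> (r + Re w) * (t + r)\<^sup>2" using assms(2) by (intro mult_right_mono) (auto simp: r_def)
  also have "\<dots> \<le> 2 * r * (t\<^sup>2 + 2 * t * Re w + r\<^sup>2)" using rR by (simp add: power2_eq_square algebra_simps)
  finally show ?thesis using r n r_def by simp
qed

text \<open>
  Multiplying \<open>\<Sum>n. z ^ n / (n + w)\<close> by \<open>1 - z\<close> and collecting equal powers of \<open>z\<close> produces the
  differences \<open>1 / (n + w) - 1 / (n + 1 + w)\<close>. The summands become \<open>O(1 / n\<^sup>2)\<close>, so the series
  converges absolutely even on the unit circle.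
\<close>

definition lerch_series :: "complex \<Rightarrow> complex \<Rightarrow> complex" where
  "lerch_series z w =
     (1 / w - (\<Sum>n. z ^ Suc n / ((of_nat n + w) * (of_nat (Suc n) + w)))) / (1 - z)"

text \<open>
  In the sector the summands are at most
  \<open>1 / \<eta> * (1 / (n + \<bar>w\<bar>) - 1 / (n + 1 + \<bar>w\<bar>))\<close>, and these bounds telescope to \<open>1 / (\<eta> * \<bar>w\<bar>)\<close>.
\<close>

lemma norm_lerch_series_le:
  assumes z: "norm z \<le> 1" and w: "w \<noteq> 0" and \<eta>: "\<eta> > 0" "2 * \<eta> * norm w \<le> norm w + Re w"
  shows "norm (lerch_series z w) \<le> (1 + 1 / \<eta>) / (norm w * norm (1 - z))"
proof -
  define r where "r = norm w"
  have r: "r > 0" using w by (simp add: r_def)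
  define h where "h = (\<lambda>n. 1 / \<eta> * (1 / (real n + r)))"
  let ?a = "\<lambda>n. z ^ Suc n / ((of_nat n + w) * (of_nat (Suc n) + w))"
  have "h \<longlonglongrightarrow> 0" unfolding h_def by real_asymp
  then have sums: "(\<lambda>n. h n - h (Suc n)) sums (h 0 - 0)" by (rule telescope_sums')
  have shift: "sqrt \<eta> * (real n + r) \<le> norm (of_nat n + w)" for n
    using real_sqrt_le_mono[OF norm_shift_ge[OF w \<eta>(2), of "real n"]] r
    by (simp add: real_sqrt_mult r_def)
  have pos: "sqrt \<eta> * (real n + r) > 0" for n using \<eta> r by (simp add: add_nonneg_pos)
  have le: "norm (?a n) \<le> h n - h (Suc n)" for n
  proof -
    have "norm (?a n) \<le> 1 / (norm (of_nat n + w) * norm (of_nat (Suc n) + w))"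
      using power_le_one[OF norm_ge_zero z, of "Suc n"]
      by (simp only: norm_divide norm_mult norm_power) (intro divide_right_mono; simp)
    also have "\<dots> \<le> 1 / ((sqrt \<eta> * (real n + r)) * (sqrt \<eta> * (real (Suc n) + r)))"
      using shift[of n] shift[of "Suc n"] pos[of n] pos[of "Suc n"]
      by (intro frac_le mult_mono mult_pos_pos[OF pos pos]) linarith+
    also have "\<dots> = 1 / (\<eta> * ((real n + r) * (real (Suc n) + r)))"
      using \<eta> by (simp add: mult_ac flip: mult.assoc[of "sqrt \<eta>" "sqrt \<eta>"])
    also have "\<dots> = h n - h (Suc n)"
      unfolding h_def using r \<eta> by (simp add: divide_simps)
    finally show ?thesis .
  qed
  have "norm (suminf ?a) \<le> (\<Sum>n. h n - h (Suc n))"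
    by (rule norm_suminf_le[OF le sums_summable[OF sums]])
  also have "\<dots> = 1 / \<eta> * (1 / r)" using sums_unique[OF sums] by (simp add: h_def)
  finally have "norm (1 / w - suminf ?a) \<le> 1 / r + 1 / \<eta> * (1 / r)"
    using norm_triangle_ineq4[of "1 / w" "suminf ?a"] by (simp add: norm_divide r_def)
  then have "norm (lerch_series z w) \<le> (1 / r + 1 / \<eta> * (1 / r)) / norm (1 - z)"
    unfolding lerch_series_def norm_divide by (rule divide_right_mono) simp
  also have "1 / r + 1 / \<eta> * (1 / r) = (1 + 1 / \<eta>) / r" by (simp add: add_divide_distrib)
  finally show ?thesis by (simp add: r_def)
qed

lemma holomorphic_lerch_series:
  assumes z: "norm z \<le> 1"
  shows "lerch_series z holomorphic_on - \<int>\<^sub>\<le>\<^sub>0"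
proof -
  let ?S = "- \<int>\<^sub>\<le>\<^sub>0 :: complex set"
  let ?a = "\<lambda>n w. z ^ Suc n / ((of_nat n + w) * (of_nat (Suc n) + w))"
  have nz: "of_nat n + w \<noteq> 0" if "w \<in> ?S" for n w
    using that minus_of_nat_in_nonpos_Ints[of n]
    by (metis ComplD add.commute add_eq_0_iff)
  have "(\<lambda>w. \<Sum>n. ?a n w) holomorphic_on ?S"
  proof (rule holomorphic_uniform_sequence[where f = "\<lambda>N w. \<Sum>n<N. ?a n w"])
    show "open ?S" by (simp add: open_Compl)
    show "(\<lambda>w. \<Sum>n<N. ?a n w) holomorphic_on ?S" for N
      by (intro holomorphic_intros) (use nz in \<open>auto simp del: of_nat_Suc\<close>)
    fix w0 assume "w0 \<in> ?S"
    then obtain d where d: "d > 0" "cball w0 d \<subseteq> ?S"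
      using \<open>open ?S\<close> open_contains_cball by blast
    define R where "R = norm w0 + d"
    have "uniform_limit (cball w0 d) (\<lambda>N w. \<Sum>n<N. ?a n w) (\<lambda>w. suminf (\<lambda>n. ?a n w)) sequentially"
    proof (rule Weierstrass_m_test_ev[where M = "\<lambda>n. 4 * inverse (real n ^ 2)"])
      show "summable (\<lambda>n. 4 * inverse (real n ^ 2))"
        by (intro summable_mult inverse_power_summable) simp
      have "\<forall>\<^sub>F n in sequentially. real n \<ge> 2 * R" by real_asymp
      then show "\<forall>\<^sub>F n in sequentially. \<forall>w\<in>cball w0 d. norm (?a n w) \<le> 4 * inverse (real n ^ 2)"
        using eventually_gt_at_top[of 0]
      proof eventually_elim
        case (elim n)
        show ?case
        proof
          fix w assume "w \<in> cball w0 d"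
          then have "norm w \<le> R"
            unfolding R_def by (metis add_left_mono dist_norm mem_cball norm_minus_commute norm_triangle_sub order_trans)
          have shift: "real n / 2 \<le> norm (of_nat m + w)" if "n \<le> m" for m
          proof -
            have "real n / 2 \<le> real m - norm w" using elim that \<open>norm w \<le> R\<close> by simp
            also have "\<dots> \<le> norm (of_nat m + w)"
              using norm_diff_ineq[of "of_nat m" w] by simp
            finally show ?thesis .
          qed
          have "norm (?a n w) \<le> 1 / (norm (of_nat n + w) * norm (of_nat (Suc n) + w))"
            using power_le_one[OF norm_ge_zero z, of "Suc n"]
            by (simp only: norm_divide norm_mult norm_power) (intro divide_right_mono; simp)
          also have "\<dots> \<le> 1 / ((real n / 2) * (real n / 2))"
            using shift[of n] shift[of "Suc n"] elim
            by (intro divide_left_mono mult_mono mult_pos_pos) (auto intro: less_le_trans[of 0])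
          finally show "norm (?a n w) \<le> 4 * inverse (real n ^ 2)"
            by (simp add: power2_eq_square field_simps)
        qed
      qed
    qed
    with d show "\<exists>d. 0 < d \<and> cball w0 d \<subseteq> ?S \<and>
        uniform_limit (cball w0 d) (\<lambda>N w. \<Sum>n<N. ?a n w) (\<lambda>w. suminf (\<lambda>n. ?a n w)) sequentially"
      by blast
  qed
  then show ?thesis
    unfolding lerch_series_def divide_inverse[of _ "1 - z"]
    by (intro holomorphic_intros) auto
qed

section \<open>Lerch integrals along rays\<close>

lemma norm_one_minus_exp_le:
  fixes q :: complex assumes "Re q \<ge> 0"
  shows "norm (1 - exp (- q)) \<le> norm q"
proof -
  have "norm (exp (- 0) - exp (- q)) \<le> 1 * norm (0 - q)"
    by (rule field_differentiable_bound[where S = "{q. Re q \<ge> 0}" and f' = "\<lambda>q. - exp (- q)"])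
       (use assms in \<open>auto intro!: derivative_eq_intros convex_halfspace_Re_ge\<close>)
  then show ?thesis by simp
qed

text \<open>
  The decomposition \<open>(1 - z) / (1 - z E) = 1 - z * (1 - E) / (1 - z E)\<close> with \<open>E = exp (- u r)\<close> is the
  summation by parts on the level of integrands. The extra factor \<open>1 - E\<close> vanishes to first order at
  \<open>r = 0\<close>, which makes the integrals of the terms of the geometric series absolutely summable
  although \<open>\<bar>z\<bar> = 1\<close> is allowed. The direction \<open>u\<close> of the ray is free: it cancels from every term.
\<close>

lemma lerch_ray_integral:
  assumes z: "norm z \<le> 1" "z \<noteq> 1" and u: "Re u > 0" and wu: "Re (w * u) > 0"
  shows "has_bochner_integral lborel
    (\<lambda>r. indicator {0..} r *\<^sub>R (u * (exp (- (w * u) * of_real r) / (1 - z * exp (- u * of_real r)))))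
    (lerch_series z w)"
proof -
  let ?E = "\<lambda>r::real. indicator {0..} r :: real"
  let ?a = "\<lambda>n. z ^ Suc n / ((of_nat n + w) * (of_nat (Suc n) + w))"
  let ?e = "\<lambda>n r. exp (- ((of_nat n + w) * u) * of_real r) :: complex"
  define f where "f = (\<lambda>n r. u * z ^ Suc n * (?E r *\<^sub>R ?e n r - ?E r *\<^sub>R ?e (Suc n) r))"
  define b where "b = Re (w * u)"
  \<comment> \<open>A common decay rate: the exponent of the \<open>n\<close>-th term has real part at least \<open>m * (n + 1)\<close>.\<close>
  define m where "m = min (Re u) b"
  have m: "m > 0" "m \<le> Re u" "m \<le> b" using u wu by (auto simp: m_def b_def)
  have Re_nw: "Re ((of_nat n + w) * u) = real n * Re u + b" for n
    by (simp add: b_def algebra_simps)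
  have Re_pos: "Re ((of_nat n + w) * u) > 0" for n
    unfolding Re_nw using m u by (simp add: add_nonneg_pos)
  have u0: "u \<noteq> 0" using u by auto
  have nz: "of_nat n + w \<noteq> 0" for n
    using Re_pos[of n] by (metis less_irrefl mult_zero_left zero_complex.simps(1))

  have f_int: "has_bochner_integral lborel (f n) (?a n)" for n
  proof -
    have "has_bochner_integral lborel (f n)
       (u * z ^ Suc n * (1 / ((of_nat n + w) * u) - 1 / ((of_nat (Suc n) + w) * u)))"
      unfolding f_def
      by (intro has_bochner_integral_mult_right has_bochner_integral_diff laplace_complex Re_pos)
    also have "u * z ^ Suc n * (1 / ((of_nat n + w) * u) - 1 / ((of_nat (Suc n) + w) * u)) = ?a n"
      using nz[of n] nz[of "Suc n"] u0 by (simp add: divide_simps del: power_Suc)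
    finally show ?thesis .
  qed

  have e_Suc: "?e (Suc n) r = ?e n r * exp (- (u * of_real r))" for n r
    by (simp add: exp_add[symmetric] algebra_simps)
  have f_eq: "f n r = ?E r *\<^sub>R (u * z ^ Suc n * (?e n r * (1 - exp (- (u * of_real r)))))" for n r
    by (simp only: f_def e_Suc right_diff_distrib mult_1_right scaleR_diff_right mult_scaleR_right)
  have f_le: "norm (f n r) \<le> (norm u)\<^sup>2 * (?E r *\<^sub>R (r * exp (- (m * real (Suc n)) * r)))" for n r
  proof (cases "r \<ge> 0")
    case True
    have "norm (f n r) = norm u * norm z ^ Suc n * (norm (?e n r) * norm (1 - exp (- (u * of_real r))))"
      unfolding f_eq using True by (simp add: norm_mult norm_power del: norm_exp_eq_Re)
    also have "\<dots> \<le> norm u * 1 * (exp (- (m * real (Suc n)) * r) * (norm u * r))"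
    proof (intro mult_mono mult_nonneg_nonneg)
      show "norm z ^ Suc n \<le> 1" using z by (intro power_le_one) auto
      have "m * real (Suc n) \<le> real n * Re u + b"
        using m mult_left_mono[OF m(2), of "real n"] by (simp add: algebra_simps)
      then have "- Re ((of_nat n + w) * u) * r \<le> - (m * real (Suc n)) * r"
        unfolding Re_nw using True by (intro mult_right_mono) auto
      then show "norm (?e n r) \<le> exp (- (m * real (Suc n)) * r)" by (simp add: algebra_simps)
      show "norm (1 - exp (- (u * of_real r))) \<le> norm u * r"
        using norm_one_minus_exp_le[of "u * of_real r"] u True by (simp add: norm_mult)
    qed (use True in auto)
    finally show ?thesis using True by (simp add: power2_eq_square mult_ac)
  qed (simp add: f_def)

  have int: "integrable lborel (\<lambda>r. \<Sum>n. f n r)"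
    and sums: "(\<lambda>n. integral\<^sup>L lborel (f n)) sums (\<integral>r. (\<Sum>n. f n r) \<partial>lborel)"
  proof -
    have A: "integrable lborel (f n)" for n using f_int by (rule integrable.intros)
    have B: "AE r in lborel. summable (\<lambda>n. norm (f n r))"
    proof (rule AE_I2)
      fix r :: real
      show "summable (\<lambda>n. norm (f n r))"
      proof (cases "r > 0")
        case True
        show ?thesis
        proof (rule summable_comparison_test')
          have "summable (\<lambda>n. exp (- m * r) ^ Suc n)"
            unfolding summable_Suc_iff using m True by (intro summable_geometric) simp
          then show "summable (\<lambda>n. (norm u)\<^sup>2 * (r * exp (- m * r) ^ Suc n))"
            by (intro summable_mult)
          show "norm (norm (f n r)) \<le> (norm u)\<^sup>2 * (r * exp (- m * r) ^ Suc n)" if "n \<ge> 0" for n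
            using f_le[of n r] True by (simp add: exp_of_nat_mult[symmetric] mult_ac del: of_nat_Suc power_Suc)
        qed
      next
        case False
        then have "f n r = 0" for n by (cases "r = 0") (auto simp: f_def)
        then show ?thesis by simp
      qed
    qed
    have C: "summable (\<lambda>n. \<integral>r. norm (f n r) \<partial>lborel)"
    proof (rule summable_comparison_test')
      have "summable (\<lambda>n. inverse (real (Suc n) ^ 2))"
        unfolding summable_Suc_iff[of "\<lambda>n. inverse (real n ^ 2)"] by (intro inverse_power_summable) simp
      then show "summable (\<lambda>n. (norm u)\<^sup>2 / m\<^sup>2 * inverse (real (Suc n) ^ 2))"
        by (intro summable_mult)
      fix n :: nat
      note L = laplace_real_id[of "m * real (Suc n)"]
      have "(\<integral>r. norm (f n r) \<partial>lborel) \<le> (\<integral>r. (norm u)\<^sup>2 * (?E r *\<^sub>R (r * exp (- (m * real (Suc n)) * r))) \<partial>lborel)"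
        by (intro integral_mono A integrable_norm f_le integrable_mult_right integrable.intros[OF L]) (use m in simp)
      also have "\<dots> = (norm u)\<^sup>2 * (1 / (m * real (Suc n))\<^sup>2)"
        by (intro has_bochner_integral_integral_eq has_bochner_integral_mult_right L) (use m in simp)
      finally show "norm (\<integral>r. norm (f n r) \<partial>lborel) \<le> (norm u)\<^sup>2 / m\<^sup>2 * inverse (real (Suc n) ^ 2)"
        by (simp add: power_mult_distrib divide_inverse mult_ac del: of_nat_Suc)
    qed
    show "integrable lborel (\<lambda>r. \<Sum>n. f n r)" by (rule integrable_suminf[OF A B C])
    show "(\<lambda>n. integral\<^sup>L lborel (f n)) sums (\<integral>r. (\<Sum>n. f n r) \<partial>lborel)" by (rule sums_integral[OF A B C])
  qed
  have val: "(\<integral>r. (\<Sum>n. f n r) \<partial>lborel) = suminf ?a"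
    using sums_unique[OF sums] has_bochner_integral_integral_eq[OF f_int] by simp

  have main: "has_bochner_integral lborel
      (\<lambda>r. (u * (?E r *\<^sub>R exp (- (w * u) * of_real r)) - (\<Sum>n. f n r)) / (1 - z))
      ((u * (1 / (w * u)) - suminf ?a) / (1 - z))"
    by (intro has_bochner_integral_divide_zero has_bochner_integral_diff has_bochner_integral_mult_right laplace_complex wu)
       (simp add: has_bochner_integral_iff int val)
  have pointwise: "(u * (?E r *\<^sub>R exp (- (w * u) * of_real r)) - (\<Sum>n. f n r)) / (1 - z)
      = ?E r *\<^sub>R (u * (exp (- (w * u) * of_real r) / (1 - z * exp (- u * of_real r))))" for r
  proof -
    consider "r < 0" | "r = 0" | "r > 0" by linarith
    then show ?thesis
    proof cases
      case 3
      define E where "E = exp (- (u * of_real r))"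
      define W where "W = exp (- (w * u * of_real r))"
      have "norm E < 1" unfolding E_def using u 3 by simp
      then have zE: "norm (z * E) < 1"
        using mult_left_le_one_le[of "norm E" "norm z"] z by (simp add: norm_mult)
      then have ne: "1 - z * E \<noteq> 0" by auto
      have "?e n r = W * E ^ n" for n
        unfolding W_def E_def by (simp add: exp_of_nat_mult[symmetric] exp_add[symmetric] algebra_simps)
      then have "f n r = u * W * (1 - E) * z * (z * E) ^ n" for n
        using 3 by (simp add: f_eq power_mult_distrib flip: E_def)
      moreover have "(\<lambda>n. u * W * (1 - E) * z * (z * E) ^ n) sums (u * W * (1 - E) * z * (1 / (1 - z * E)))"
        by (intro sums_mult geometric_sums zE)
      ultimately have S: "(\<Sum>n. f n r) = u * W * (1 - E) * z / (1 - z * E)"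
        using sums_unique by fastforce
      have "(u * W - (\<Sum>n. f n r)) / (1 - z) = u * (W / (1 - z * E))"
        unfolding S using ne z(2) by (simp add: divide_simps) (simp add: algebra_simps)
      then show ?thesis using 3 by (simp add: E_def W_def)
    qed (simp_all add: f_def)
  qed
  have "u * (1 / (w * u)) = 1 / w" using u0 by simp
  then show ?thesis using main unfolding pointwise lerch_series_def by simp
qed

text \<open>
  The ray integral with \<open>u = 1\<close> shows that the series is one of the functions among which \<open>lerch1 z\<close> is
  chosen, and the identity theorem on the connected complement of a countable closed set leaves
  no other.
\<close>

lemma lerch1_eq_lerch_series:
  assumes z: "norm z \<le> 1" "z \<noteq> 1" and w: "w \<notin> \<int>\<^sub>\<le>\<^sub>0"
  shows "lerch1 z w = lerch_series z w"
proof -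
  let ?P = "\<lambda>f. f holomorphic_on (- \<int>\<^sub>\<le>\<^sub>0) \<and>
     (\<forall>x. 0 < Re x \<longrightarrow>
        f x = (LBINT p:{0..}. exp (- x * of_real p) / (1 - z * exp (- of_real p))))"
  have P: "?P (lerch_series z)"
    using holomorphic_lerch_series[OF z(1)]
      has_bochner_integral_integral_eq[OF lerch_ray_integral[OF z, of 1]]
    by (simp add: set_lebesgue_integral_def)
  have Q: "?P (lerch1 z)"
    unfolding lerch1_def by (rule someI[of ?P, OF P])
  show ?thesis
  proof (rule analytic_continuation_open[of "{x. Re x > 0}" "- \<int>\<^sub>\<le>\<^sub>0" "lerch1 z" "lerch_series z"])
    show "open (- \<int>\<^sub>\<le>\<^sub>0 :: complex set)" by (simp add: open_Compl)
    have "countable (\<int>\<^sub>\<le>\<^sub>0 :: complex set)"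
      using countable_int by (rule countable_subset[rotated]) (auto elim: nonpos_Ints_cases)
    then show "connected (- \<int>\<^sub>\<le>\<^sub>0 :: complex set)"
      using connected_open_diff_countable[of UNIV "\<int>\<^sub>\<le>\<^sub>0 :: complex set"] by (simp add: Compl_eq_Diff_UNIV connected_UNIV)
    show "{x. Re x > 0} \<noteq> {}" by (auto intro: exI[of _ 1])
    show "{x. Re x > 0} \<subseteq> - \<int>\<^sub>\<le>\<^sub>0" by (auto elim!: nonpos_Ints_cases)
  qed (use P Q w in \<open>auto simp: open_halfspace_Re_gt\<close>)
qed

section \<open>The dyadic expansion of the Cauchy kernel\<close>

text \<open>
  With \<open>E = exp (- s / 2 ^ (k + 1))\<close>, the identity
  \<open>1 / (1 - E\<^sup>2) = (1 / 2) / (1 - E) + (1 / 2) / (1 + E)\<close> makes the partial sums telescope; the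
  remainder \<open>2 ^ (- K) / (1 - exp (- s / 2 ^ K))\<close> tends to \<open>1 / s\<close> by the derivative of \<open>exp\<close> at \<open>0\<close>.
\<close>

lemma sums_dyadic_reciprocal:
  fixes s :: complex
  assumes s: "s \<noteq> 0" and ne: "\<And>k. exp (- s / 2 ^ k) \<noteq> 1"
  shows "(\<lambda>k. (1 / 2 ^ Suc k) / (1 + exp (- s / 2 ^ Suc k))) sums (1 / (1 - exp (- s)) - 1 / s)"
proof -
  have half: "exp (- s / 2 ^ k) = exp (- s / 2 ^ Suc k) ^ 2" for k
    by (simp add: exp_double[symmetric] field_simps)
  have partial: "(\<Sum>k<K. (1 / 2 ^ Suc k) / (1 + exp (- s / 2 ^ Suc k)))
      = 1 / (1 - exp (- s)) - (1 / 2 ^ K) / (1 - exp (- s / 2 ^ K))" for K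
  proof (induction K)
    case (Suc K)
    define E where "E = exp (- s / 2 ^ Suc K)"
    have E: "E \<noteq> 1" "E\<^sup>2 \<noteq> 1" using ne[of "Suc K"] ne[of K] half[of K] by (simp_all add: E_def)
    then have "1 + E \<noteq> 0" by (metis add.commute add_eq_0_iff power2_minus one_power2)
    then have "(1 / 2 ^ Suc K) / (1 + E) = (1 / 2 ^ K) / (1 - E\<^sup>2) - (1 / 2 ^ Suc K) / (1 - E)"
      using E by (simp add: divide_simps power2_eq_square) (simp add: algebra_simps)
    then show ?case using Suc.IH half[of K] by (simp add: E_def)
  qed simp
  have "((\<lambda>t. 1 - exp (- s * t)) has_field_derivative s) (at 0)"
    by (auto intro!: derivative_eq_intros)
  then have "((\<lambda>t. (1 - exp (- s * t)) / t) \<longlongrightarrow> s) (at 0)"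
    by (simp add: DERIV_def)
  moreover have "filterlim (\<lambda>K. (1 / 2 :: complex) ^ K) (at 0) sequentially"
    by (auto simp: filterlim_at intro!: LIMSEQ_power_zero)
  ultimately have "(\<lambda>K. (1 - exp (- s * (1 / 2) ^ K)) / (1 / 2) ^ K) \<longlonglongrightarrow> s"
    by (rule filterlim_compose)
  then have "(\<lambda>K. 1 / ((1 - exp (- s * (1 / 2) ^ K)) / (1 / 2) ^ K)) \<longlonglongrightarrow> 1 / s"
    using s by (intro tendsto_intros)
  then have "(\<lambda>K. (1 / 2 ^ K) / (1 - exp (- s / 2 ^ K))) \<longlonglongrightarrow> 1 / s"
    by (simp add: power_divide mult.commute)
  then show ?thesis
    unfolding sums_def partial by (rule tendsto_diff[OF tendsto_const])
qed

text \<open>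
  The zeros of \<open>1 + exp (i \<theta> - q)\<close> lie on the imaginary axis, and for these \<open>\<theta>\<close> and \<open>c > 0\<close> the sector
  \<open>Re q \<ge> c * Im q \<ge> 0\<close> has positive distance from them. Near the origin (\<open>Im q \<le> \<pi> / 2\<close>)
  the exponential points into the right half-plane; farther out it is small. The bound is the same for
  all \<open>\<theta>\<close>, hence for all dyadic scales at once.
\<close>

lemma norm_one_plus_exp_ge:
  assumes "0 \<le> \<theta>" "\<theta> \<le> pi / 2" "c \<ge> 0" "Im q \<ge> 0" "Re q \<ge> c * Im q"
  shows "1 - exp (- (c * (pi / 2))) \<le> norm (1 + exp (\<i> * of_real \<theta> - q))"
proof (cases "Im q \<le> pi / 2")
  case True
  then have "cos (\<theta> - Im q) \<ge> 0" using assms by (intro cos_ge_zero) auto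
  then have "1 \<le> Re (1 + exp (\<i> * of_real \<theta> - q))" by (simp add: Re_exp)
  then show ?thesis
    using complex_Re_le_cmod[of "1 + exp (\<i> * of_real \<theta> - q)"] exp_gt_zero[of "- (c * (pi / 2))"] by linarith
next
  case False
  then have "c * (pi / 2) \<le> c * Im q" using assms by (intro mult_left_mono) auto
  then have "exp (- Re q) \<le> exp (- (c * (pi / 2)))" using assms by simp
  moreover have "1 - norm (exp (\<i> * of_real \<theta> - q)) \<le> norm (1 + exp (\<i> * of_real \<theta> - q))"
    using norm_diff_ineq[of 1 "exp (\<i> * of_real \<theta> - q)"] by simp
  moreover have "norm (exp (\<i> * of_real \<theta> - q)) = exp (- Re q)" by simp
  ultimately show ?thesis by linarith
qed

section \<open>The dyadic sum on the slit plane\<close>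

text \<open>
  The index is shifted: \<open>dyadic_root k\<close> is the parameter of the \<open>(k + 1)\<close>-st term of the informal series.
\<close>

abbreviation dyadic_root :: "nat \<Rightarrow> complex" where
  "dyadic_root k \<equiv> - exp (of_real pi * \<i> / 2 ^ Suc k)"

lemma norm_dyadic_root: "norm (dyadic_root k) = 1"
  by (simp add: Re_divide_numeral)

lemma dyadic_angle: "0 \<le> pi / 2 ^ Suc k" "pi / 2 ^ Suc k \<le> pi / 2"
  by (auto simp: field_simps)

text \<open>
  The roots \<open>- exp (i \<pi> / 2 ^ (k + 1))\<close> start at \<open>- i\<close> and approach \<open>- 1\<close> within the closed left half-plane,
  so they stay away from the singular parameter \<open>1\<close> uniformly in \<open>k\<close>.
\<close>

lemma norm_one_minus_dyadic_root: "1 \<le> norm (1 - dyadic_root k)"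
proof -
  have "dyadic_root k = - cis (pi / 2 ^ Suc k)" by (simp add: cis_conv_exp mult_ac)
  moreover have "cos (pi / 2 ^ Suc k) \<ge> 0" using dyadic_angle[of k] pi_gt_zero by (intro cos_ge_zero) linarith+
  ultimately show ?thesis using complex_Re_le_cmod[of "1 - dyadic_root k"] by simp
qed

lemma dyadic_root_neq_1: "dyadic_root k \<noteq> 1"
proof
  assume "dyadic_root k = 1"
  then have "norm (1 - dyadic_root k) = 0" by (simp only: diff_self norm_zero)
  then show False using norm_one_minus_dyadic_root[of k] by linarith
qed

text \<open>
  In the variable \<open>w = x / (i \<pi>)\<close> of the Lerch transcendents, the slit becomes the negative real axis.
\<close>

lemma slit_plane_iff: "x \<in> slit_plane \<longleftrightarrow> x / (\<i> * of_real pi) \<notin> \<real>\<^sub>\<le>\<^sub>0"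
proof -
  have "x \<in> (\<lambda>t::real. \<i> * of_real t) ` {..0} \<longleftrightarrow> x / (\<i> * of_real pi) \<in> \<real>\<^sub>\<le>\<^sub>0"
  proof
    assume "x \<in> (\<lambda>t::real. \<i> * of_real t) ` {..0}"
    then obtain t :: real where t: "t \<le> 0" "x = \<i> * of_real t" by auto
    then have "x / (\<i> * of_real pi) = of_real (t / pi)" by (simp add: field_simps)
    then show "x / (\<i> * of_real pi) \<in> \<real>\<^sub>\<le>\<^sub>0" using t by (simp only: nonpos_Reals_of_real_iff) (simp add: divide_nonpos_pos)
  next
    assume "x / (\<i> * of_real pi) \<in> \<real>\<^sub>\<le>\<^sub>0"
    then obtain t where t: "t \<le> 0" "x / (\<i> * of_real pi) = of_real t" by (auto elim: nonpos_Reals_cases)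
    then have "x = \<i> * of_real (pi * t)" by (simp add: field_simps)
    then show "x \<in> (\<lambda>t::real. \<i> * of_real t) ` {..0}" using t(1) by (intro image_eqI[of _ _ "pi * t"]) (auto simp: mult_nonneg_nonpos)
  qed
  then show ?thesis by (simp add: slit_plane_def)
qed

lemma open_slit_plane: "open slit_plane"
proof -
  have eq: "slit_plane = (\<lambda>x. x / (\<i> * of_real pi)) -` (- \<real>\<^sub>\<le>\<^sub>0)" by (auto simp: slit_plane_iff)
  show ?thesis unfolding eq by (intro open_vimage open_Compl closed_nonpos_Reals_complex continuous_intros) simp
qed

lemma connected_slit_plane: "connected slit_plane"
proof -
  have eq: "slit_plane = (\<lambda>w. \<i> * of_real pi * w) ` (- complex_of_real ` {..0})"
  proof (intro equalityI subsetI)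
    fix x assume "x \<in> slit_plane"
    then have "x / (\<i> * of_real pi) \<in> - complex_of_real ` {..0}" by (auto simp: slit_plane_iff nonpos_Reals_def)
    then show "x \<in> (\<lambda>w. \<i> * of_real pi * w) ` (- complex_of_real ` {..0})" by (rule rev_image_eqI) simp
  qed (auto simp: slit_plane_iff nonpos_Reals_def)
  show ?thesis unfolding eq
    by (intro connected_continuous_image continuous_intros starlike_imp_connected starlike_slotted_complex_plane_left)
qed

lemma norm_plus_Re_pos:
  fixes w :: complex
  assumes "w \<notin> \<real>\<^sub>\<le>\<^sub>0"
  shows "norm w + Re w > 0"
proof (rule ccontr)
  assume "\<not> norm w + Re w > 0"
  then have le: "norm w \<le> - Re w" by simp
  then have "(norm w)\<^sup>2 \<le> (- Re w)\<^sup>2" by (intro power_mono) auto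
  then have "Im w = 0" by (simp add: cmod_power2)
  moreover have "Re w \<le> 0" using le norm_ge_zero[of w] by linarith
  ultimately show False using assms by (simp add: complex_nonpos_Reals_iff)
qed

lemma scaled_notin_nonpos_Ints:
  fixes w :: complex
  assumes "w \<notin> \<real>\<^sub>\<le>\<^sub>0"
  shows "2 ^ k * w \<notin> \<int>\<^sub>\<le>\<^sub>0"
proof
  assume "2 ^ k * w \<in> \<int>\<^sub>\<le>\<^sub>0"
  then have "2 ^ k * w \<in> \<real>\<^sub>\<le>\<^sub>0" using nonpos_Ints_subset_nonpos_Reals by auto
  then obtain t where t: "t \<le> 0" "2 ^ k * w = of_real t" by (auto elim: nonpos_Reals_cases)
  then have "w = of_real (t / 2 ^ k)" by (simp add: field_simps)
  then show False using assms t(1) by (simp only: nonpos_Reals_of_real_iff) (simp add: divide_nonpos_pos)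
qed

text \<open>
  The sector condition is homogeneous, so it passes from \<open>w\<close> to \<open>2 ^ (k + 1) * w\<close> with the same \<open>\<eta>\<close>,
  and the \<open>O(1 / \<bar>w\<bar>)\<close> decay becomes geometric decay in \<open>k\<close>.
\<close>

lemma norm_dyadic_term_le:
  fixes w :: complex
  assumes w: "w \<noteq> 0" and \<eta>: "\<eta> > 0" "2 * \<eta> * norm w \<le> norm w + Re w"
  shows "norm (lerch_series (dyadic_root k) (2 ^ Suc k * w)) \<le> (1 + 1 / \<eta>) / norm w * (1 / 2) ^ Suc k"
proof -
  let ?w = "of_real (2 ^ Suc k) * w"
  have "2 ^ Suc k * (2 * \<eta> * norm w) \<le> 2 ^ Suc k * (norm w + Re w)"
    using \<eta>(2) by (rule mult_left_mono) simp
  then have "2 * \<eta> * norm ?w \<le> norm ?w + Re ?w"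
    by (simp add: norm_mult norm_power algebra_simps)
  then have "norm (lerch_series (dyadic_root k) ?w) \<le> (1 + 1 / \<eta>) / (norm ?w * norm (1 - dyadic_root k))"
    using w \<eta>(1) norm_dyadic_root[of k] by (intro norm_lerch_series_le) auto
  also have "\<dots> \<le> (1 + 1 / \<eta>) / (norm ?w * 1)"
    using w \<eta>(1) norm_one_minus_dyadic_root[of k]
    by (intro frac_le mult_left_mono) auto
  also have "\<dots> = (1 + 1 / \<eta>) / norm w * (1 / 2) ^ Suc k"
    by (simp add: norm_mult norm_power power_divide)
  finally show ?thesis by simp
qed

lemma dyadic_lerch_sum:
  shows summable_dyadic_lerch: "w \<notin> \<real>\<^sub>\<le>\<^sub>0 \<Longrightarrow> summable (\<lambda>k. lerch_series (dyadic_root k) (2 ^ Suc k * w))"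
    and holomorphic_dyadic_lerch:
      "(\<lambda>w. \<Sum>k. lerch_series (dyadic_root k) (2 ^ Suc k * w)) holomorphic_on - \<real>\<^sub>\<le>\<^sub>0"
proof -
  let ?T = "- \<real>\<^sub>\<le>\<^sub>0 :: complex set"
  let ?t = "\<lambda>k w. lerch_series (dyadic_root k) (2 ^ Suc k * w)"
  have M: "\<exists>M. summable M \<and> (\<forall>k. \<forall>w\<in>K. norm (?t k w) \<le> M k)"
    if K: "compact K" "K \<subseteq> ?T" for K
  proof (cases "K = {}")
    case False
    have nz: "w \<noteq> 0" if "w \<in> K" for w using that K by auto
    \<comment> \<open>The minima over \<open>K\<close> of the sector parameter and of the modulus give one bound for all of \<open>K\<close>.\<close>
    have "continuous_on K (\<lambda>w. (norm w + Re w) / (2 * norm w))"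
      by (intro continuous_intros) (use nz in auto)
    then obtain a where a: "a \<in> K" "\<And>w. w \<in> K \<Longrightarrow> (norm a + Re a) / (2 * norm a) \<le> (norm w + Re w) / (2 * norm w)"
      using continuous_attains_inf[OF K(1) False] by blast
    define \<eta> where "\<eta> = (norm a + Re a) / (2 * norm a)"
    obtain b where b: "b \<in> K" "\<And>w. w \<in> K \<Longrightarrow> norm b \<le> norm w"
      using continuous_attains_inf[OF K(1) False, of norm] by (auto intro: continuous_intros)
    have \<eta>: "\<eta> > 0" unfolding \<eta>_def using norm_plus_Re_pos[of a] a(1) K nz[of a] by auto
    have "norm (?t k w) \<le> (1 + 1 / \<eta>) / norm b * (1 / 2) ^ Suc k" if w: "w \<in> K" for k w
    proof -
      have "\<eta> \<le> (norm w + Re w) / (2 * norm w)" unfolding \<eta>_def by (rule a(2)[OF w])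
      then have "2 * \<eta> * norm w \<le> norm w + Re w"
        using nz[OF w] by (simp add: pos_le_divide_eq mult_ac)
      then have "norm (?t k w) \<le> (1 + 1 / \<eta>) / norm w * (1 / 2) ^ Suc k"
        by (intro norm_dyadic_term_le nz w \<eta>)
      also have "\<dots> \<le> (1 + 1 / \<eta>) / norm b * (1 / 2) ^ Suc k"
        using b(2)[OF w] nz[OF b(1)] nz[OF w] \<eta> by (intro mult_right_mono divide_left_mono) auto
      finally show ?thesis .
    qed
    moreover have "summable (\<lambda>k. (1 + 1 / \<eta>) / norm b * (1 / 2) ^ Suc k)"
      by (intro summable_mult) (simp add: summable_Suc_iff summable_geometric del: power_Suc)
    ultimately show ?thesis by blast
  qed (auto intro: exI[of _ "\<lambda>_. 0"])
  show "summable (\<lambda>k. ?t k w)" if "w \<notin> \<real>\<^sub>\<le>\<^sub>0"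
    using M[of "{w}"] that by (auto intro: summable_comparison_test')
  show "(\<lambda>w. \<Sum>k. ?t k w) holomorphic_on ?T"
  proof (rule holomorphic_uniform_sequence[where f = "\<lambda>N w. \<Sum>k<N. ?t k w"])
    show T: "open ?T" by (intro open_Compl closed_nonpos_Reals_complex)
    have "?t k holomorphic_on ?T" for k
    proof -
      have "(lerch_series (dyadic_root k) \<circ> (\<lambda>w. 2 ^ Suc k * w)) holomorphic_on ?T"
      proof (rule holomorphic_on_compose_gen)
        show "lerch_series (dyadic_root k) holomorphic_on - \<int>\<^sub>\<le>\<^sub>0"
          by (intro holomorphic_lerch_series eq_refl norm_dyadic_root)
        show "(\<lambda>w. 2 ^ Suc k * w) ` ?T \<subseteq> - \<int>\<^sub>\<le>\<^sub>0"
          using scaled_notin_nonpos_Ints by blast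
      qed (intro holomorphic_intros)
      then show ?thesis by (simp add: o_def)
    qed
    then show "(\<lambda>w. \<Sum>k<N. ?t k w) holomorphic_on ?T" for N
      by (intro holomorphic_intros)
    fix w assume "w \<in> ?T"
    then obtain d where d: "d > 0" "cball w d \<subseteq> ?T" using T open_contains_cball by blast
    obtain M where M: "summable M" "\<forall>k. \<forall>v\<in>cball w d. norm (?t k v) \<le> M k"
      using M[OF compact_cball d(2)] by (elim exE conjE)
    have "uniform_limit (cball w d) (\<lambda>N w. \<Sum>k<N. ?t k w) (\<lambda>w. \<Sum>k. ?t k w) sequentially"
      by (rule Weierstrass_m_test[OF _ M(1)]) (use M(2) in blast)
    with d show "\<exists>d. 0 < d \<and> cball w d \<subseteq> ?T \<and>
        uniform_limit (cball w d) (\<lambda>N w. \<Sum>k<N. ?t k w) (\<lambda>w. \<Sum>k. ?t k w) sequentially"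
      by blast
  qed
qed

section \<open>The exponential integral\<close>

text \<open>
  The candidate for \<open>exp (- x) * Ei_plus x\<close>, in the variable \<open>w = x / (i \<pi>)\<close>.
\<close>

definition Ei_series :: "complex \<Rightarrow> complex" where
  "Ei_series w = - lerch_series (- 1) w + (\<Sum>k. lerch_series (dyadic_root k) (2 ^ Suc k * w))"

text \<open>
  Since \<open>1 < \<pi> / 2\<close>, the restriction of the two angles ensures that \<open>exp (- p x)\<close> decays along
  \<open>p = r * cis \<phi>\<close>, and that \<open>i \<pi> p\<close> runs in the open first quadrant, where the geometric
  expansions converge and the denominators are bounded below.
\<close>

lemma Ei_ray_eq:
  assumes x: "0 < Arg x" "Arg x < 1" and \<phi>: "-1 < \<phi>" "\<phi> < 0"
  shows "Ei_ray \<phi> x = exp x * Ei_series (x / (\<i> * of_real pi))"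
proof -
  let ?E = "\<lambda>r::real. indicator {0..} r :: real"
  define v where "v = cis \<phi>"
  define w where "w = x / (\<i> * of_real pi)"
  define q where "q = \<i> * of_real pi * v"
  define u where "u = (\<lambda>k. q / 2 ^ Suc k)"
  have x0: "x \<noteq> 0" using x by (auto simp: Arg_zero)
  have pi2: "pi / 2 > 1" using pi_gt3 by simp
  have xv: "Re (x * v) > 0"
  proof -
    have "x * v = of_real (norm x) * cis (Arg x + \<phi>)"
      by (metis cis_mult mult.assoc rcis_cmod_Arg rcis_def v_def)
    moreover have "cos (Arg x + \<phi>) > 0" using x \<phi> pi2 by (intro cos_gt_zero_pi) auto
    ultimately show ?thesis using x0 by simp
  qed
  have Im_v: "Im v < 0" using \<phi> pi2 sin_gt_zero[of "- \<phi>"] by (simp add: v_def)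
  have q: "Re q > 0" "Im q > 0"
  proof -
    have "pi * Im v < 0" using Im_v by (simp add: mult_pos_neg)
    then show "Re q > 0" by (simp add: q_def)
    have "cos \<phi> > 0" using \<phi> pi2 by (intro cos_gt_zero_pi) auto
    then show "Im q > 0" by (simp add: q_def v_def)
  qed
  have u: "Re (u k) > 0" "Im (u k) > 0" for k
  proof -
    have "u k = q / of_real (2 ^ Suc k)" by (simp add: u_def)
    then show "Re (u k) > 0" "Im (u k) > 0" using q by (simp_all only: Re_divide_of_real Im_divide_of_real) simp_all
  qed
  have wq: "w * q = x * v" by (simp add: w_def q_def)
  have wu: "(2 ^ Suc k * w) * u k = x * v" for k unfolding wq[symmetric] u_def by simp

  define g where "g = (\<lambda>r. ?E r *\<^sub>R (q * (exp (- (x * v) * of_real r) / (1 - (- 1) * exp (- q * of_real r)))))"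
  define f where "f = (\<lambda>k r. ?E r *\<^sub>R (u k * (exp (- (x * v) * of_real r) / (1 - dyadic_root k * exp (- u k * of_real r)))))"
  have g_int: "has_bochner_integral lborel g (lerch_series (- 1) w)"
    unfolding g_def wq[symmetric] by (rule lerch_ray_integral) (use q xv wq in auto)
  have f_int: "has_bochner_integral lborel (f k) (lerch_series (dyadic_root k) (2 ^ Suc k * w))" for k
    unfolding f_def wu[of k, symmetric]
    by (rule lerch_ray_integral) (use u xv wu norm_dyadic_root[of k] dyadic_root_neq_1[of k] in auto)

  \<comment> \<open>Every \<open>u k * r\<close> lies on the ray through \<open>q\<close>, so one slope \<open>c\<close> bounds all denominators below by \<open>d\<close>.\<close>
  define c where "c = Re q / Im q"
  define d where "d = 1 - exp (- (c * (pi / 2)))"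
  have c: "c > 0" using q by (simp add: c_def)
  then have d: "d > 0" by (simp add: d_def)
  have denom: "d \<le> norm (1 - dyadic_root k * exp (- u k * of_real r))" if "r \<ge> 0" for k r
  proof -
    define t where "t = r / 2 ^ Suc k"
    have t: "t \<ge> 0" using that by (simp add: t_def)
    have "u k * of_real r = q * of_real t" by (simp add: u_def t_def)
    then have ur: "Im (u k * of_real r) = Im q * t" "Re (u k * of_real r) = Re q * t"
      by simp_all
    have "d \<le> norm (1 + exp (\<i> * of_real (pi / 2 ^ Suc k) - u k * of_real r))"
      unfolding d_def
    proof (rule norm_one_plus_exp_ge)
      show "Re (u k * of_real r) \<ge> c * Im (u k * of_real r)" unfolding ur c_def using q by simp
      show "Im (u k * of_real r) \<ge> 0" unfolding ur using q t by simp
    qed (use dyadic_angle[of k] c in auto)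
    also have "1 + exp (\<i> * of_real (pi / 2 ^ Suc k) - u k * of_real r) = 1 - dyadic_root k * exp (- u k * of_real r)"
      by (simp add: exp_add[symmetric] mult.commute)
    finally show ?thesis .
  qed
  have f_le: "norm (f k r) \<le> (norm q / d * (1 / 2) ^ Suc k) * (?E r *\<^sub>R exp (- Re (x * v) * r))" for k r
  proof (cases "r \<ge> 0")
    case True
    have "norm (f k r) = norm (u k) * (exp (- Re (x * v) * r) / norm (1 - dyadic_root k * exp (- u k * of_real r)))"
      unfolding f_def using True by (simp add: norm_mult norm_divide algebra_simps)
    also have "\<dots> \<le> norm (u k) * (exp (- Re (x * v) * r) / d)"
      using denom[OF True, of k] d by (intro mult_left_mono frac_le) auto
    also have "norm (u k) = norm q * (1 / 2) ^ Suc k"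
      by (simp add: u_def norm_divide norm_mult norm_power power_divide)
    finally show ?thesis using True by (simp add: mult_ac)
  qed (simp add: f_def)

  have sum_int: "has_bochner_integral lborel (\<lambda>r. \<Sum>k. f k r) (\<Sum>k. lerch_series (dyadic_root k) (2 ^ Suc k * w))"
  proof -
    have geo: "summable (\<lambda>k. norm q / d * (1 / 2) ^ Suc k)"
      by (intro summable_mult) (simp add: summable_Suc_iff summable_geometric del: power_Suc)
    have A: "integrable lborel (f k)" for k using f_int by (rule integrable.intros)
    have B: "AE r in lborel. summable (\<lambda>k. norm (f k r))"
      by (intro AE_I2 summable_comparison_test'[OF summable_mult2[OF geo]]) (use f_le in auto)
    have C: "summable (\<lambda>k. \<integral>r. norm (f k r) \<partial>lborel)"
    proof (rule summable_comparison_test')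
      note L = laplace_real[OF xv]
      show "summable (\<lambda>k. (norm q / d * (1 / 2) ^ Suc k) * (1 / Re (x * v)))"
        by (rule summable_mult2[OF geo])
      fix k :: nat
      have "(\<integral>r. norm (f k r) \<partial>lborel) \<le> (\<integral>r. (norm q / d * (1 / 2) ^ Suc k) * (?E r *\<^sub>R exp (- Re (x * v) * r)) \<partial>lborel)"
        by (intro integral_mono A integrable_norm f_le integrable_mult_right integrable.intros[OF L])
      also have "\<dots> = (norm q / d * (1 / 2) ^ Suc k) * (1 / Re (x * v))"
        by (intro has_bochner_integral_integral_eq has_bochner_integral_mult_right L)
      finally show "norm (\<integral>r. norm (f k r) \<partial>lborel) \<le> (norm q / d * (1 / 2) ^ Suc k) * (1 / Re (x * v))"
        by simp
    qed
    show ?thesis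
      using integrable_suminf[OF A B C] integral_suminf[OF A B C] has_bochner_integral_integral_eq[OF f_int]
      by (simp add: has_bochner_integral_iff)
  qed

  \<comment> \<open>At \<open>r = 0\<close> the expansion would need a separate argument, since \<open>Re s = 0\<close> there; one point is a null set.\<close>
  have pointwise: "(\<Sum>k. f k r) - g r = ?E r *\<^sub>R (v * (exp (- (of_real r * v) * x) / (1 - of_real r * v)))"
    if "r \<noteq> 0" for r
  proof (cases "r > 0")
    case True
    \<comment> \<open>This is \<open>s = i \<pi> (p - 1)\<close> at \<open>p = r * cis \<phi>\<close>; the term \<open>- i \<pi>\<close> turns \<open>1 - exp (- s)\<close> into \<open>1 + exp (- i \<pi> p)\<close>.\<close>
    define s where "s = q * of_real r - \<i> * of_real pi"
    define W where "W = exp (- (x * v) * of_real r)"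
    have "Re s > 0" using q True by (simp add: s_def)
    then have s0: "s \<noteq> 0" by auto
    have "exp (- s / 2 ^ k) \<noteq> 1" for k
    proof -
      have "- s / 2 ^ k = - s / of_real (2 ^ k)" by simp
      then have "Re (- s / 2 ^ k) < 0" using \<open>Re s > 0\<close> by (simp only: Re_divide_of_real) simp
      then show ?thesis by (metis norm_exp_eq_Re norm_one less_irrefl exp_less_one_iff)
    qed
    then have S: "(\<lambda>k. q * W * ((1 / 2 ^ Suc k) / (1 + exp (- s / 2 ^ Suc k)))) sums (q * W * (1 / (1 - exp (- s)) - 1 / s))"
      by (intro sums_mult sums_dyadic_reciprocal s0) auto
    have "f k r = q * W * ((1 / 2 ^ Suc k) / (1 + exp (- s / 2 ^ Suc k)))" for k
    proof -
      have "- s / 2 ^ Suc k = of_real pi * \<i> / 2 ^ Suc k + - u k * of_real r"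
        by (simp add: s_def u_def diff_divide_distrib mult_ac)
      then have "dyadic_root k * exp (- u k * of_real r) = - exp (- s / 2 ^ Suc k)"
        by (simp only: exp_add) simp
      then show ?thesis using True by (simp add: f_def W_def u_def)
    qed
    then have "(\<Sum>k. f k r) = q * W * (1 / (1 - exp (- s)) - 1 / s)"
      using sums_unique[OF S] by simp
    moreover have "exp (- s) = - exp (- q * of_real r)"
      by (simp add: s_def exp_diff exp_minus field_simps)
    ultimately have "(\<Sum>k. f k r) - g r = q * W * (- 1 / s)"
      using True by (simp add: g_def W_def algebra_simps)
    also have "s = \<i> * of_real pi * (of_real r * v - 1)"
      by (simp add: s_def q_def algebra_simps)
    also have "q * W * (- 1 / (\<i> * of_real pi * (of_real r * v - 1))) = v * (W / (1 - of_real r * v))"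
      using minus_divide_right[of "v * W" "of_real r * v - 1"] by (simp add: q_def)
    finally show ?thesis using True by (simp add: W_def mult_ac)
  qed (use that in \<open>simp add: f_def g_def\<close>)

  have "(LBINT r:{0..}. cis \<phi> * (exp (- (of_real r * cis \<phi>) * x) / (1 - of_real r * cis \<phi>)))
      = (\<integral>r. (\<Sum>k. f k r) - g r \<partial>lborel)"
    unfolding set_lebesgue_integral_def
  proof (rule integral_cong_AE)
    show "AE r in lborel. ?E r *\<^sub>R (cis \<phi> * (exp (- (of_real r * cis \<phi>) * x) / (1 - of_real r * cis \<phi>)))
        = (\<Sum>k. f k r) - g r"
      using AE_lborel_singleton[of 0] by eventually_elim (simp add: pointwise v_def)
    show "(\<lambda>r. (\<Sum>k. f k r) - g r) \<in> borel_measurable lborel"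
      using sum_int g_int by (intro borel_measurable_diff borel_measurable_has_bochner_integral)
  qed simp
  also have "\<dots> = Ei_series w"
    unfolding Ei_series_def
    using has_bochner_integral_integral_eq[OF has_bochner_integral_diff[OF sum_int g_int]] by simp
  finally show ?thesis unfolding Ei_ray_def w_def by simp
qed

lemma holomorphic_exp_Ei_series:
  "(\<lambda>x. exp x * Ei_series (x / (\<i> * of_real pi))) holomorphic_on slit_plane"
proof -
  have "Ei_series holomorphic_on - \<real>\<^sub>\<le>\<^sub>0"
    unfolding Ei_series_def[abs_def]
    by (intro holomorphic_intros holomorphic_dyadic_lerch holomorphic_on_subset[OF holomorphic_lerch_series])
       (use nonpos_Ints_subset_nonpos_Reals in auto)
  then have "(Ei_series \<circ> (\<lambda>x. x / (\<i> * of_real pi))) holomorphic_on slit_plane"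
    by (rule holomorphic_on_compose_gen[rotated]) (auto intro!: holomorphic_intros simp: slit_plane_iff)
  then show ?thesis by (intro holomorphic_intros) (simp add: o_def)
qed

text \<open>
  The dyadic sum satisfies the condition that defines \<open>Ei_plus\<close>, with \<open>\<epsilon> = 1\<close>. Whatever \<open>\<epsilon>\<close> belongs to the
  chosen function, both agree on a thin open sector above the positive axis, hence on the slit plane.
\<close>

lemma Ei_plus_eq:
  assumes "x \<in> slit_plane"
  shows "Ei_plus x = exp x * Ei_series (x / (\<i> * of_real pi))"
proof -
  let ?P = "\<lambda>f. f holomorphic_on slit_plane \<and>
     (\<exists>\<epsilon>>0. \<forall>x \<phi>. 0 < Arg x \<and> Arg x < \<epsilon> \<and> - \<epsilon> < \<phi> \<and> \<phi> < 0 \<longrightarrow> f x = Ei_ray \<phi> x)"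
  let ?F = "\<lambda>x. exp x * Ei_series (x / (\<i> * of_real pi))"
  have F: "?P ?F"
  proof
    show "\<exists>\<epsilon>>0. \<forall>x \<phi>. 0 < Arg x \<and> Arg x < \<epsilon> \<and> - \<epsilon> < \<phi> \<and> \<phi> < 0 \<longrightarrow> ?F x = Ei_ray \<phi> x"
      by (rule exI[of _ 1]) (simp add: Ei_ray_eq)
  qed (rule holomorphic_exp_Ei_series)
  have P: "?P Ei_plus"
    unfolding Ei_plus_def by (rule someI[of ?P ?F, OF F])
  from P obtain \<epsilon> where \<epsilon>: "\<epsilon> > 0"
    "\<And>x \<phi>. \<lbrakk>0 < Arg x; Arg x < \<epsilon>; - \<epsilon> < \<phi>; \<phi> < 0\<rbrakk> \<Longrightarrow> Ei_plus x = Ei_ray \<phi> x" by blast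
  define \<delta> where "\<delta> = min \<epsilon> 1"
  have \<delta>: "\<delta> > 0" "\<delta> \<le> \<epsilon>" "\<delta> \<le> 1" using \<epsilon> by (auto simp: \<delta>_def)
  define U where "U = {x. Im x > 0} \<inter> Arg -` {..<\<delta>}"
  show ?thesis
  proof (rule analytic_continuation_open[of U slit_plane Ei_plus ?F])
    have "continuous_on {x. Im x > 0} Arg"
      by (rule continuous_on_subset[OF continuous_on_Arg]) (auto simp: complex_nonpos_Reals_iff)
    then show "open U"
      unfolding U_def by (intro continuous_open_preimage) (auto simp: open_halfspace_Im_gt)
    show "U \<noteq> {}"
    proof -
      have "Arg (cis (\<delta> / 2)) = \<delta> / 2" using \<delta> pi_gt3 by (intro Arg_cis) auto
      moreover have "Im (cis (\<delta> / 2)) > 0" using \<delta> pi_gt3 by (auto intro!: sin_gt_zero)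
      ultimately have "cis (\<delta> / 2) \<in> U" using \<delta> by (simp add: U_def)
      then show ?thesis by blast
    qed
    show "U \<subseteq> slit_plane" by (auto simp: U_def slit_plane_def)
    show "Ei_plus y = ?F y" if "y \<in> U" for y
    proof -
      have y: "0 < Arg y" "Arg y < \<delta>" using that Arg_lt_pi[of y] by (auto simp: U_def)
      have "Ei_plus y = Ei_ray (- \<delta> / 2) y" by (rule \<epsilon>(2)) (use y \<delta> in auto)
      also have "\<dots> = ?F y" by (rule Ei_ray_eq) (use y \<delta> in auto)
      finally show ?thesis .
    qed
    show "Ei_plus holomorphic_on slit_plane" using P by (rule conjunct1)
    show "?F holomorphic_on slit_plane" by (rule holomorphic_exp_Ei_series)
  qed (use assms in \<open>simp_all add: open_slit_plane connected_slit_plane\<close>)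
qed

theorem mainTheorem4:
  fixes x :: complex
  assumes "x \<in> slit_plane"
  shows "summable (\<lambda>k. lerch1 (- exp (of_real pi * \<i> / 2 ^ Suc k)) (2 ^ Suc k * (x / (\<i> * of_real pi))))
    \<and> exp (- x) * Ei_plus x =
           - lerch1 (- 1) (x / (\<i> * of_real pi)) +
           (\<Sum>k. lerch1 (- exp (of_real pi * \<i> / 2 ^ Suc k)) (2 ^ Suc k * (x / (\<i> * of_real pi))))"
proof -
  define w where "w = x / (\<i> * of_real pi)"
  have w: "w \<notin> \<real>\<^sub>\<le>\<^sub>0" using assms by (simp add: slit_plane_iff w_def)
  have terms: "lerch1 (dyadic_root k) (2 ^ Suc k * w) = lerch_series (dyadic_root k) (2 ^ Suc k * w)" for k
    by (intro lerch1_eq_lerch_series scaled_notin_nonpos_Ints w dyadic_root_neq_1 eq_refl norm_dyadic_root)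
  have first: "lerch1 (- 1) w = lerch_series (- 1) w"
    using scaled_notin_nonpos_Ints[OF w, of 0] by (intro lerch1_eq_lerch_series) auto
  have "exp (- x) * Ei_plus x = Ei_series w"
    using Ei_plus_eq[OF assms] by (simp add: exp_minus w_def)
  then show ?thesis
    using summable_dyadic_lerch[OF w]
    by (simp only: w_def[symmetric] terms first Ei_series_def)
qed

end
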